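(* Let $X$, $Y$ be topological spaces where $Y$ is Hausdorff, and let $g:X\to Y$ be a continuous map. Then $(X,Y;g)$ has the coincidence property if and only if $\mathrm{sec}_g(\pi_{2,1}^Y)=2$.
   Context: Maps are continuous. For a map $g:X\to Y$, the triple $(X,Y;g)$ has the coincidence property (CP) if for every map $f:X\to Y$ there is a point $x\in X$ with $f(x)=g(x)$. $F(Y,2)=\{(y_1,y_2)\in Y^2\mid y_1\neq y_2\}$ with the subspace topology from $Y^2$, and $\pi_{2,1}^Y:F(Y,2)\to Y$ is $\pi_{2,1}^Y(y_1,y_2)=y_1$. The sectional number $\mathrm{sec}(f)$ of a map $f:A\to B$ is the minimal cardinality of open covers of $B$ such that each element $U$ of the cover admits a local section of $f$, i.e. a map $s:U\to A$ with $f\circ s$ equal to the inclusion $U\hookrightarrow B$ (with value $\infty$ if no finite such cover exists). For maps $p:E\to B$ and $g:X\to B$, the relative sectional number $\mathrm{sec}_g(p)$ is $\mathrm{sec}(g^\ast(p))$, where $g^\ast(p):X\times_B E\to X$, $(x,e)\mapsto x$, is the canonical pullback, $X\times_B E=\{(x,e)\in X\times E: g(x)=p(e)\}$. Equivalently, $\mathrm{sec}_g(p)$ is the minimal cardinality of open covers $\{U_i\}_{1\le i\le n}$ of $X$ such that for each $i$ there is a map $\sigma_i:U_i\to E$ with $p\circ\sigma_i=g_{|U_i}$.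
   Formalization: The formal theorem additionally assumes that Y is not a one-point space when X is nonempty; in that excluded case the coincidence property holds but F(Y,2) is empty, so the relative sectional number is infinite and the printed claim fails. *)

theory Defs
  imports "HOL-Analysis.T1_Spaces" "HOL-Library.Extended_Nat"
begin

definition coincidence_property :: "'a topology \<Rightarrow> 'b topology \<Rightarrow> ('a \<Rightarrow> 'b) \<Rightarrow> bool" where
  "coincidence_property X Y g \<longleftrightarrow>
     (\<forall>f. continuous_map X Y f \<longrightarrow> (\<exists>x\<in>topspace X. f x = g x))"

definition config_space2 :: "'a topology \<Rightarrow> ('a \<times> 'a) topology" where
  "config_space2 Y = subtopology (prod_topology Y Y) {(y1, y2). y1 \<noteq> y2}"

definition config_proj :: "'a \<times> 'a \<Rightarrow> 'a" where
  "config_proj = (\<lambda>(y1, y2). y1)"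

definition has_local_section ::
    "'a topology \<Rightarrow> 'b topology \<Rightarrow> ('a \<Rightarrow> 'b) \<Rightarrow> 'b set \<Rightarrow> bool" where
  "has_local_section A B f U \<longleftrightarrow>
     (\<exists>s. continuous_map (subtopology B U) A s \<and> (\<forall>x\<in>U. f (s x) = x))"

(* The infimum over the empty set is \<infinity>, the value when no finite cover by
   domains of local sections exists.  The empty cover is allowed, so an empty
   base has sectional number 0. *)
definition sectional_number ::
    "'a topology \<Rightarrow> 'b topology \<Rightarrow> ('a \<Rightarrow> 'b) \<Rightarrow> enat" where
  "sectional_number A B f =
     Inf {enat (card \<U>) | \<U>. finite \<U> \<and> \<Union>\<U> = topspace B \<and>
            (\<forall>U\<in>\<U>. openin B U \<and> has_local_section A B f U)}"

definition pullback_space ::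
    "'x topology \<Rightarrow> 'e topology \<Rightarrow> ('x \<Rightarrow> 'b) \<Rightarrow> ('e \<Rightarrow> 'b) \<Rightarrow> ('x \<times> 'e) topology" where
  "pullback_space X E g p = subtopology (prod_topology X E) {(x, e). g x = p e}"

(* The base space does not occur: the pullback needs only the values of g and p. *)
definition relative_sectional_number ::
    "'x topology \<Rightarrow> 'e topology \<Rightarrow> ('x \<Rightarrow> 'b) \<Rightarrow> ('e \<Rightarrow> 'b) \<Rightarrow> enat" where
  "relative_sectional_number X E g p = sectional_number (pullback_space X E g p) X fst"

end

theory Submission
  imports Defs
begin

text \<open>
  A local section over \<open>U\<close> of the pullback of the projection along \<open>g\<close> amounts to a map
  \<open>U \<rightarrow> Y\<close> without coincidence with \<open>g\<close>; in particular, the coincidence property says that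
  there is no global section. Two sections always suffice when \<open>Y\<close> has distinct points
  \<open>y\<close> and \<open>z\<close>: the constant maps with values \<open>y\<close> and \<open>z\<close> avoid \<open>g\<close> on the open sets
  where \<open>g x \<noteq> y\<close> and \<open>g x \<noteq> z\<close>, and these two sets cover \<open>X\<close>.
\<close>

text \<open>The pullback condition forces a section to have the form
  \<open>x \<mapsto> (x, (g x, f x))\<close>: only the second point of the configuration is free,
  and distinctness of the two points says that \<open>f\<close> avoids \<open>g\<close>.\<close>

lemma has_local_section_pullback_config_iff:
  assumes g: "continuous_map X Y g" and U: "U \<subseteq> topspace X"
  shows "has_local_section (pullback_space X (config_space2 Y) g config_proj) X fst U \<longleftrightarrow>
    (\<exists>f. continuous_map (subtopology X U) Y f \<and> (\<forall>x\<in>U. f x \<noteq> g x))"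
proof
  assume "has_local_section (pullback_space X (config_space2 Y) g config_proj) X fst U"
  then obtain s
    where s: "continuous_map (subtopology X U) (pullback_space X (config_space2 Y) g config_proj) s"
      and fst_s: "\<forall>x\<in>U. fst (s x) = x"
    unfolding has_local_section_def by blast
  have cont: "continuous_map (subtopology X U) (prod_topology Y Y) (snd \<circ> s)"
    and conf: "\<And>x. x \<in> U \<Longrightarrow> config_proj (snd (s x)) = g (fst (s x)) \<and> fst (snd (s x)) \<noteq> snd (snd (s x))"
    using s U unfolding pullback_space_def config_space2_def
    by (auto simp: continuous_map_in_subtopology continuous_map_pairwise topspace_subtopology_subset
        image_subset_iff Pi_iff case_prod_beta)
  have "continuous_map (subtopology X U) Y (snd \<circ> (snd \<circ> s))"
    by (rule continuous_map_compose[OF cont continuous_map_snd])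
  moreover have "(snd \<circ> (snd \<circ> s)) x \<noteq> g x" if "x \<in> U" for x
    using conf[OF that] fst_s that by (metis comp_apply config_proj_def split_beta)
  ultimately show "\<exists>f. continuous_map (subtopology X U) Y f \<and> (\<forall>x\<in>U. f x \<noteq> g x)"
    by blast
next
  assume "\<exists>f. continuous_map (subtopology X U) Y f \<and> (\<forall>x\<in>U. f x \<noteq> g x)"
  then obtain f where f: "continuous_map (subtopology X U) Y f" and ne: "\<forall>x\<in>U. f x \<noteq> g x"
    by blast
  have "continuous_map (subtopology X U) (pullback_space X (config_space2 Y) g config_proj)
          (\<lambda>x. (x, (g x, f x)))"
    using f ne U continuous_map_from_subtopology[OF g, of U]
      continuous_map_from_subtopology[OF continuous_map_id, of X U]
    unfolding pullback_space_def config_space2_def config_proj_def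
    by (auto simp: continuous_map_in_subtopology continuous_map_pairwise o_def id_def
        topspace_subtopology_subset)
  then show "has_local_section (pullback_space X (config_space2 Y) g config_proj) X fst U"
    unfolding has_local_section_def by (intro exI conjI) auto
qed

lemma sectional_number_le:
  assumes "finite \<U>" "\<Union>\<U> = topspace B" "\<And>U. U \<in> \<U> \<Longrightarrow> openin B U \<and> has_local_section A B f U"
  shows "sectional_number A B f \<le> enat (card \<U>)"
  unfolding sectional_number_def using assms by (intro Inf_lower) blast

text \<open>An empty cover misses the points of \<open>B\<close>, and the only member of a
  one-element cover is \<open>topspace B\<close> itself.\<close>

lemma sectional_number_ge_2:
  assumes "topspace B \<noteq> {}" and "\<not> has_local_section A B f (topspace B)"
  shows "2 \<le> sectional_number A B f"
  unfolding sectional_number_def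
proof (rule Inf_greatest, clarify)
  fix \<U> assume fin: "finite \<U>" and cover: "\<Union>\<U> = topspace B"
    and sec: "\<forall>U\<in>\<U>. openin B U \<and> has_local_section A B f U"
  have "card \<U> \<noteq> 0"
    using fin cover assms(1) by (metis Union_empty card_0_eq)
  moreover have "card \<U> \<noteq> 1"
    using cover sec assms(2) by (auto simp: card_1_singleton_iff)
  ultimately show "2 \<le> enat (card \<U>)"
    by (simp add: numeral_eq_enat)
qed

theorem theorem3p8:
  fixes X :: "'a topology" and Y :: "'b topology" and g :: "'a \<Rightarrow> 'b"
  assumes "Hausdorff_space Y"
    and "continuous_map X Y g"
    and "topspace X \<noteq> {} \<Longrightarrow> \<nexists>y. topspace Y = {y}"
  shows "coincidence_property X Y g \<longleftrightarrow>
         relative_sectional_number X (config_space2 Y) g config_proj = 2"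
proof -
  let ?P = "pullback_space X (config_space2 Y) g config_proj"
  note section_iff = has_local_section_pullback_config_iff[OF assms(2)]
  have CP_iff: "coincidence_property X Y g \<longleftrightarrow> \<not> has_local_section ?P X fst (topspace X)"
    unfolding section_iff[OF subset_refl] coincidence_property_def by auto
  show ?thesis
    unfolding relative_sectional_number_def
  proof
    assume CP: "coincidence_property X Y g"
    \<comment> \<open>Taking \<open>f = g\<close> in the coincidence property yields a point of
      \<open>X\<close>.\<close>
    then have ne: "topspace X \<noteq> {}"
      using assms(2) unfolding coincidence_property_def by blast
    \<comment> \<open>\<open>Y\<close> contains a value of \<open>g\<close> and is not a single
      point. Over a one-point \<open>Y\<close> the configuration space would be empty and the
      sectional number infinite, although the coincidence property holds.\<close>
    obtain y z where yz: "y \<in> topspace Y" "z \<in> topspace Y" "y \<noteq> z"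
      using ne assms(3) continuous_map_image_subset_topspace[OF assms(2)] by blast
    define U where "U w = {x \<in> topspace X. g x \<in> topspace Y - {w}}" for w
    have U: "openin X (U w) \<and> has_local_section ?P X fst (U w)" if "w \<in> topspace Y" for w
    proof
      \<comment> \<open>The Hausdorff hypothesis enters here: points are closed.\<close>
      have "openin Y (topspace Y - {w})"
        using that closedin_Hausdorff_singleton[OF assms(1)] by blast
      then show open_U: "openin X (U w)"
        unfolding U_def by (rule openin_continuous_map_preimage[OF assms(2)])
      have "continuous_map (subtopology X (U w)) Y (\<lambda>_. w)" "\<forall>x\<in>U w. w \<noteq> g x"
        using that by (auto simp: U_def)
      then show "has_local_section ?P X fst (U w)"
        unfolding section_iff[OF openin_subset[OF open_U]] by blast
    qed
    have "\<Union>{U y, U z} = topspace X"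
      using yz continuous_map_image_subset_topspace[OF assms(2)] by (auto simp: U_def)
    then have "sectional_number ?P X fst \<le> enat (card {U y, U z})"
      using U yz by (intro sectional_number_le) auto
    \<comment> \<open>Only an upper bound on the cardinality, so \<open>U y\<close> and
      \<open>U z\<close> need not be shown distinct.\<close>
    also have "\<dots> \<le> 2"
      by (simp add: numeral_eq_enat card_insert_if)
    finally have "sectional_number ?P X fst \<le> 2" .
    moreover have "2 \<le> sectional_number ?P X fst"
      using sectional_number_ge_2[OF ne] CP CP_iff by blast
    ultimately show "sectional_number ?P X fst = 2"
      by (rule antisym)
  next
    assume "sectional_number ?P X fst = 2"
    \<comment> \<open>A global section would make \<open>{topspace X}\<close> an admissible cover
      and bound the sectional number by 1.\<close>
    then have "\<not> has_local_section ?P X fst (topspace X)"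
      using sectional_number_le[of "{topspace X}" X ?P fst]
      by (auto simp: numeral_eq_enat)
    then show "coincidence_property X Y g"
      using CP_iff by blast
  qed
qed

end
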